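(* Let $v_{l,t}$, $v_{-k}$ be the costs defined in the context, and let $(u_{k,l,t})_{l,t}$ be the realized utilities of user $k$. Then the pricing strategy $$p_{k,l,t}=v_{l,t}-v_{-k}\qquad (l\in\{1,\dots,L\},\ t\in\{t_k+1,\dots,T\})$$ maximizes the social welfare; that is, it maximizes $$\sum_{l=1}^{L}\sum_{t=t_k+1}^{T}(u_{k,l,t}-v_{l,t}+v_{-k})\,A_{k,l,t}(\mathbf{p}_k)$$ over all price menus $\mathbf p_k=(p_{k,l,t})_{l,t}$ with $p_{k,l,t}\ge 0$.
   Context: Contracts and user. User $k$ arrives at a charging station at time $t_k<T$ (discrete time, horizon $T$). A contract is a pair $(l,t)$ with energy level $l\in\{1,\dots,L\}$ and deadline $t\in\{t_k+1,\dots,T\}$. The station posts a price $p_{k,l,t}\ge 0$ for every contract; $\mathbf p_k=(p_{k,l,t})_{l,t}$ (the value $+\infty$ is allowed; a contract with infinite price is never accepted, and its terms in all sums are read as $0$). User $k$ has realized real utility $u_{k,l,t}$ for contract $(l,t)$, and utility $0$ if it rejects all contracts. Given $\mathbf p_k$ the user is a price taker and chooses $A_{k,l,t}(\mathbf p_k)\in[0,1]$ to maximize $\sum_{l,t}A_{k,l,t}(u_{k,l,t}-p_{k,l,t})$ subject to $\sum_{l,t}A_{k,l,t}\le 1$: it chooses a contract (or any convex combination of contracts) attaining the maximal payoff $\max_{i,j}(u_{k,i,j}-p_{k,i,j})$ if this maximum is $\ge 0$ (ties between charging and not charging are resolved in favour of charging, so then $\sum_{l,t} A_{k,l,t}=1$),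 and all $A_{k,l,t}=0$ if the maximum is negative. Costs. $\mathcal K_0$ is the set of users already present at time $t_k$; user $i\in\mathcal K_0$ has deadline $w_i$ and remaining demand $N_i$. Known data: conventional energy prices $c_t\ge0$, harvested energies $\bar E^t\ge 0$, maximal charging rate $R_{max}$, battery capacity $B_{max}$, initial battery level $B_0\in[0,B_{max}]$. For a contract $(l,d)$, $v_{l,d}$ is the optimal value of the linear program: minimize $\sum_{t=t_k}^{T-1}c_tq_t$ over nonnegative variables $r_{k,t},q_{k,t},r_{i,t},q_{i,t}\ (i\in\mathcal K_0),\,q_t,r_t,D_t$ (for $t_k\le t\le T-1$) and battery levels $B^t$, subject to (a) $\sum_{t=t_k}^{d-1}(r_{k,t}+q_{k,t})\ge l$; (b) $\sum_{t=t_k}^{w_i-1}(r_{i,t}+q_{i,t})\ge N_i$ for all $i\in\mathcal K_0$; (c) $r_{k,t}+q_{k,t}\le R_{max}$ and $r_{i,t}+q_{i,t}\le R_{max}$ for all $i\in\mathcal K_0$ and all $t$; (d) $r_{k,t}+\sum_{i\in\mathcal K_0}r_{i,t}=r_t$ and $q_{k,t}+\sum_{i\in\mathcal K_0}q_{i,t}\le q_t$ for all $t$; (e) $B^{t+1}=B^t+\bar E^t-r_t+q_t-q_{k,t}-\sum_{i\in\mathcal K_0}q_{i,t}-D_t$, $0\le B^{t+1}\le B_{max}$, $B^{t_k}=B_0$, $B^T=B_0$. If the program is infeasible, $v_{l,d}=\infty$. $v_{-k}$ is the optimal value of the same program with $r_{k,t}=q_{k,t}=0$ for all $t$ and constraint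 (a) dropped (the cost of serving only the existing users), assumed finite. These costs do not depend on the prices, and $v_{l,t}-v_{-k}\ge 0$. Social welfare is the sum of the user surplus and the station's profit, i.e. $\sum_{l,t}(u_{k,l,t}-v_{l,t}+v_{-k})A_{k,l,t}(\mathbf p_k)$. *)

theory Defs
  imports Complex_Main "HOL-Library.Extended_Real"
begin

record 'i station =
  arrival :: nat                    \<comment> \<open>arrival time \<open>t\<^sub>k\<close> of user \<open>k\<close>\<close>
  horizon :: nat                    \<comment> \<open>\<open>T\<close>\<close>
  max_level :: nat                  \<comment> \<open>\<open>L\<close>\<close>
  present :: "'i set"               \<comment> \<open>the users already present at time \<open>t\<^sub>k\<close>, without \<open>k\<close>\<close>
  deadline :: "'i \<Rightarrow> nat"            \<comment> \<open>\<open>w\<^sub>i\<close>\<close>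
  demand :: "'i \<Rightarrow> real"             \<comment> \<open>\<open>N\<^sub>i\<close>\<close>
  energy_price :: "nat \<Rightarrow> real"      \<comment> \<open>\<open>c\<^sub>t\<close>\<close>
  harvest :: "nat \<Rightarrow> real"           \<comment> \<open>harvested energy at time \<open>t\<close>\<close>
  max_rate :: real                  \<comment> \<open>\<open>R\<^sub>m\<^sub>a\<^sub>x\<close>\<close>
  capacity :: real                  \<comment> \<open>\<open>B\<^sub>m\<^sub>a\<^sub>x\<close>\<close>
  battery0 :: real                  \<comment> \<open>\<open>B\<^sub>0\<close>\<close>

definition valid_station :: "'i station \<Rightarrow> bool" where
  "valid_station S \<longleftrightarrow>
     arrival S < horizon S \<and>
     finite (present S) \<and>
     (\<forall>i\<in>present S. deadline S i \<le> horizon S) \<and>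
     (\<forall>t\<in>{arrival S..<horizon S}. 0 \<le> energy_price S t \<and> 0 \<le> harvest S t) \<and>
     0 \<le> battery0 S \<and> battery0 S \<le> capacity S"

definition contracts :: "'i station \<Rightarrow> (nat \<times> nat) set" where
  "contracts S = {1..max_level S} \<times> {arrival S + 1..horizon S}"


text \<open>
  The variables of the linear program. Their values outside the time range of the program are
  irrelevant: neither the constraints nor the objective depend on them.
\<close>

record 'i schedule =
  r_new :: "nat \<Rightarrow> real"             \<comment> \<open>\<open>r\<^sub>k\<^sub>,\<^sub>t\<close>\<close>
  q_new :: "nat \<Rightarrow> real"             \<comment> \<open>\<open>q\<^sub>k\<^sub>,\<^sub>t\<close>\<close>
  r_user :: "'i \<Rightarrow> nat \<Rightarrow> real"       \<comment> \<open>\<open>r\<^sub>i\<^sub>,\<^sub>t\<close>\<close>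
  q_user :: "'i \<Rightarrow> nat \<Rightarrow> real"       \<comment> \<open>\<open>q\<^sub>i\<^sub>,\<^sub>t\<close>\<close>
  r_total :: "nat \<Rightarrow> real"           \<comment> \<open>\<open>r\<^sub>t\<close>\<close>
  q_total :: "nat \<Rightarrow> real"           \<comment> \<open>\<open>q\<^sub>t\<close>\<close>
  discard :: "nat \<Rightarrow> real"           \<comment> \<open>\<open>D\<^sub>t\<close>\<close>
  battery :: "nat \<Rightarrow> real"           \<comment> \<open>battery level at time \<open>t\<close>\<close>

text \<open>All constraints of the linear program except the demand of user \<open>k\<close>.\<close>

definition base_feasible :: "'i station \<Rightarrow> 'i schedule \<Rightarrow> bool" where
  "base_feasible S x \<longleftrightarrow>
     (\<forall>t\<in>{arrival S..<horizon S}.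
        0 \<le> r_new x t \<and> 0 \<le> q_new x t \<and>
        (\<forall>i\<in>present S. 0 \<le> r_user x i t \<and> 0 \<le> q_user x i t) \<and>
        0 \<le> r_total x t \<and> 0 \<le> q_total x t \<and> 0 \<le> discard x t) \<and>
     (\<forall>i\<in>present S. (\<Sum>t\<in>{arrival S..<deadline S i}. r_user x i t + q_user x i t) \<ge> demand S i) \<and>
     (\<forall>t\<in>{arrival S..<horizon S}.
        r_new x t + q_new x t \<le> max_rate S \<and>
        (\<forall>i\<in>present S. r_user x i t + q_user x i t \<le> max_rate S)) \<and>
     (\<forall>t\<in>{arrival S..<horizon S}.
        r_new x t + (\<Sum>i\<in>present S. r_user x i t) = r_total x t \<and>
        q_new x t + (\<Sum>i\<in>present S. q_user x i t) \<le> q_total x t) \<and>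
     (\<forall>t\<in>{arrival S..<horizon S}.
        battery x (t + 1) = battery x t + harvest S t - r_total x t + q_total x t
          - q_new x t - (\<Sum>i\<in>present S. q_user x i t) - discard x t \<and>
        0 \<le> battery x (t + 1) \<and> battery x (t + 1) \<le> capacity S) \<and>
     battery x (arrival S) = battery0 S \<and>
     battery x (horizon S) = battery0 S"

definition contract_feasible :: "'i station \<Rightarrow> nat \<Rightarrow> nat \<Rightarrow> 'i schedule \<Rightarrow> bool" where
  "contract_feasible S l d x \<longleftrightarrow>
     base_feasible S x \<and> (\<Sum>t\<in>{arrival S..<d}. r_new x t + q_new x t) \<ge> real l"

definition existing_feasible :: "'i station \<Rightarrow> 'i schedule \<Rightarrow> bool" where
  "existing_feasible S x \<longleftrightarrow>
     base_feasible S x \<and> (\<forall>t\<in>{arrival S..<horizon S}. r_new x t = 0 \<and> q_new x t = 0)"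

definition energy_cost :: "'i station \<Rightarrow> 'i schedule \<Rightarrow> real" where
  "energy_cost S x = (\<Sum>t\<in>{arrival S..<horizon S}. energy_price S t * q_total x t)"

text \<open>
  \<open>contract_cost S l d\<close> is \<open>v\<^sub>l\<^sub>,\<^sub>d\<close> and \<open>existing_cost S\<close> is \<open>v\<^sub>-\<^sub>k\<close>. An infeasible program has
  value \<open>\<infinity>\<close>, since the infimum of the empty set in \<^typ>\<open>ereal\<close> is \<open>\<infinity>\<close>.
\<close>

definition contract_cost :: "'i station \<Rightarrow> nat \<Rightarrow> nat \<Rightarrow> ereal" where
  "contract_cost S l d = (INF x\<in>{x. contract_feasible S l d x}. ereal (energy_cost S x))"

definition existing_cost :: "'i station \<Rightarrow> ereal" where
  "existing_cost S = (INF x\<in>{x. existing_feasible S x}. ereal (energy_cost S x))"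


definition price_menu :: "'i station \<Rightarrow> (nat \<Rightarrow> nat \<Rightarrow> ereal) \<Rightarrow> bool" where
  "price_menu S p \<longleftrightarrow> (\<forall>(l, t)\<in>contracts S. 0 \<le> p l t)"

definition choice :: "'i station \<Rightarrow> (nat \<Rightarrow> nat \<Rightarrow> real) \<Rightarrow> bool" where
  "choice S a \<longleftrightarrow>
     (\<forall>(l, t)\<in>contracts S. 0 \<le> a l t \<and> a l t \<le> 1) \<and> (\<Sum>(l, t)\<in>contracts S. a l t) \<le> 1"

text \<open>
  In \<^typ>\<open>ereal\<close>, \<open>0 * - \<infinity> = 0\<close> and \<open>a * - \<infinity> = - \<infinity>\<close> for \<open>a > 0\<close>. So a contract with infinite price
  contributes \<open>0\<close> when it is not accepted, and accepting it with positive weight is never optimal.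
  Since prices and costs are never \<open>- \<infinity>\<close>, no sum below contains \<open>\<infinity>\<close>.
\<close>

definition user_surplus ::
  "'i station \<Rightarrow> (nat \<Rightarrow> nat \<Rightarrow> real) \<Rightarrow> (nat \<Rightarrow> nat \<Rightarrow> ereal) \<Rightarrow> (nat \<Rightarrow> nat \<Rightarrow> real) \<Rightarrow> ereal" where
  "user_surplus S u p a = (\<Sum>(l, t)\<in>contracts S. ereal (a l t) * (ereal (u l t) - p l t))"

text \<open>
  The second conjunct resolves ties between charging and not charging in favour of charging.
\<close>

definition user_response ::
  "'i station \<Rightarrow> (nat \<Rightarrow> nat \<Rightarrow> real) \<Rightarrow> (nat \<Rightarrow> nat \<Rightarrow> ereal) \<Rightarrow> (nat \<Rightarrow> nat \<Rightarrow> real) \<Rightarrow> bool" where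
  "user_response S u p a \<longleftrightarrow>
     is_arg_max (user_surplus S u p) (choice S) a \<and>
     ((\<exists>(l, t)\<in>contracts S. 0 \<le> ereal (u l t) - p l t) \<longrightarrow> (\<Sum>(l, t)\<in>contracts S. a l t) = 1)"

definition social_welfare ::
  "'i station \<Rightarrow> (nat \<Rightarrow> nat \<Rightarrow> real) \<Rightarrow> (nat \<Rightarrow> nat \<Rightarrow> real) \<Rightarrow> ereal" where
  "social_welfare S u a =
     (\<Sum>(l, t)\<in>contracts S.
        (ereal (u l t) - contract_cost S l t + existing_cost S) * ereal (a l t))"

definition marginal_cost_price :: "'i station \<Rightarrow> nat \<Rightarrow> nat \<Rightarrow> ereal" where
  "marginal_cost_price S l t = contract_cost S l t - existing_cost S"

end

theory Submission
  imports Defs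
begin

text \<open>
  At marginal cost prices the user pays exactly the extra cost that the accepted contract causes,
  so the payoff \<open>u - p\<close> of every contract is its contribution \<open>u - v\<^sub>l\<^sub>,\<^sub>t + v\<^sub>-\<^sub>k\<close> to the welfare, and
  the surplus of the user as a function of the choice coincides with the social welfare
  (\<open>social_welfare_eq_user_surplus\<close>). The user, maximizing the surplus over all choices, therefore
  maximizes the welfare over all choices; any other menu only induces some other choice.

  It remains to see that the marginal costs form a menu, that is, that they are nonnegative. This
  holds because a schedule that serves user \<open>k\<close> can be turned, at the same cost, into one that
  serves only the existing users, by discarding the energy meant for user \<open>k\<close>
  (\<open>existing_cost_le_contract_cost\<close>).
\<close>

text \<open>
  The total \<open>q_total\<close> of purchased energy is left unchanged, which keeps the cost; the battery
  levels are unchanged because everything that user \<open>k\<close> received, from the battery or from the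
  grid, is discarded at the same time.
\<close>

definition withhold_from_new :: "'i station \<Rightarrow> 'i schedule \<Rightarrow> 'i schedule" where
  "withhold_from_new S x = x\<lparr>
     r_new := \<lambda>t. 0,
     q_new := \<lambda>t. 0,
     r_total := \<lambda>t. \<Sum>i\<in>present S. r_user x i t,
     discard := \<lambda>t. discard x t + r_new x t + q_new x t\<rparr>"

lemma energy_cost_withhold_from_new [simp]:
  "energy_cost S (withhold_from_new S x) = energy_cost S x"
  by (simp add: energy_cost_def withhold_from_new_def)

lemma existing_feasible_withhold_from_new:
  assumes "base_feasible S x"
  shows "existing_feasible S (withhold_from_new S x)"
proof -
  let ?I = "{arrival S..<horizon S}"
  have new: "0 \<le> r_new x t" "0 \<le> q_new x t" "r_new x t + q_new x t \<le> max_rate S"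
    and total: "r_new x t + (\<Sum>i\<in>present S. r_user x i t) = r_total x t"
      "q_new x t + (\<Sum>i\<in>present S. q_user x i t) \<le> q_total x t"
    and battery: "battery x (t + 1) = battery x t + harvest S t - r_total x t + q_total x t
        - q_new x t - (\<Sum>i\<in>present S. q_user x i t) - discard x t"
    if "t \<in> ?I" for t
    using assms that unfolding base_feasible_def by blast+
  have "0 \<le> max_rate S" "(\<Sum>i\<in>present S. q_user x i t) \<le> q_total x t" if "t \<in> ?I" for t
    using new[OF that] total[OF that] by linarith+
  moreover have "0 \<le> (\<Sum>i\<in>present S. r_user x i t)" if "t \<in> ?I" for t
    using assms that unfolding base_feasible_def by (intro sum_nonneg) blast
  moreover have "battery x (t + 1) = battery x t + harvest S t - (\<Sum>i\<in>present S. r_user x i t)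
      + q_total x t - 0 - (\<Sum>i\<in>present S. q_user x i t)
      - (discard x t + r_new x t + q_new x t)" if "t \<in> ?I" for t
    using battery[OF that] total(1)[OF that] by linarith
  ultimately show ?thesis
    using assms unfolding existing_feasible_def base_feasible_def withhold_from_new_def
    by simp
qed

lemma existing_cost_le_contract_cost: "existing_cost S \<le> contract_cost S l d"
  unfolding existing_cost_def contract_cost_def
proof (rule INF_mono)
  fix x assume "x \<in> {x. contract_feasible S l d x}"
  then have "existing_feasible S (withhold_from_new S x)"
    by (simp add: contract_feasible_def existing_feasible_withhold_from_new)
  then show "\<exists>y\<in>{y. existing_feasible S y}. ereal (energy_cost S y) \<le> ereal (energy_cost S x)"
    by (intro bexI[of _ "withhold_from_new S x"]) simp_all
qed

lemma price_menu_marginal_cost_price: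
  assumes "\<bar>existing_cost S\<bar> \<noteq> \<infinity>"
  shows "price_menu S (marginal_cost_price S)"
  using assms existing_cost_le_contract_cost[of S]
  by (auto simp: price_menu_def marginal_cost_price_def intro!: ereal_diff_positive)

text \<open>
  The contract cost may be \<open>\<infinity>\<close>; finiteness of the existing cost is what allows it to be moved
  from the welfare term into the price.
\<close>

lemma social_welfare_eq_user_surplus:
  assumes "\<bar>existing_cost S\<bar> \<noteq> \<infinity>"
  shows "social_welfare S u a = user_surplus S u (marginal_cost_price S) a"
proof -
  have "ereal (u l t) - contract_cost S l t + existing_cost S
      = ereal (u l t) - (contract_cost S l t - existing_cost S)" for l t
    using assms by (cases "existing_cost S"; cases "contract_cost S l t") auto
  then show ?thesis
    by (simp add: social_welfare_def user_surplus_def marginal_cost_price_def mult.commute)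
qed

theorem theorem2:
  fixes S :: "'i station"
    and u :: "nat \<Rightarrow> nat \<Rightarrow> real"
    and A :: "(nat \<Rightarrow> nat \<Rightarrow> ereal) \<Rightarrow> nat \<Rightarrow> nat \<Rightarrow> real"
  assumes "valid_station S"
    and "\<bar>existing_cost S\<bar> \<noteq> \<infinity>"
    and "\<And>p. price_menu S p \<Longrightarrow> user_response S u p (A p)"
  shows "is_arg_max (\<lambda>p. social_welfare S u (A p)) (price_menu S) (marginal_cost_price S)"
proof -
  have menu: "price_menu S (marginal_cost_price S)"
    using assms(2) by (rule price_menu_marginal_cost_price)
  have "is_arg_max (user_surplus S u (marginal_cost_price S)) (choice S) (A (marginal_cost_price S))"
    using assms(3)[OF menu] by (simp add: user_response_def)
  moreover have "choice S (A p)" if "price_menu S p" for p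
    using assms(3)[OF that] by (simp add: user_response_def is_arg_max_def)
  ultimately show ?thesis
    using menu by (auto simp: is_arg_max_def social_welfare_eq_user_surplus[OF assms(2)])
qed

end
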